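(* Consider the diffusively-corrected macroscopic model (defined in the context) for two classes of vehicles ($N=2$), linearized around a constant state $\rho_0$, with perturbations of frequency $\xi>0$, and let $M=\epsilon TD+\frac{i}{\xi}J\in\mathbb{C}^{2\times2}$, where $D=D(\rho_0)$, $J=J(\rho_0)$. The two eigenvalues $\lambda_1^M,\lambda_2^M$ of $M$ satisfy $\lambda^2-\operatorname{tr}(M)\lambda+\det(M)=0$, and $\operatorname{tr}(M)=T_R+iT_I$, $\det(M)=D_R+iD_I$ with $$T_R=\epsilon\operatorname{tr}(TD),\qquad T_I=\frac1\xi\operatorname{tr}(J),$$ $$D_R=\epsilon^2\det(TD)-\frac{1}{\xi^2}\det(J),\qquad D_I=\frac{\epsilon}{\xi}\big(\operatorname{tr}(TD)\operatorname{tr}(J)-\operatorname{tr}(TDJ)\big).$$ Stability requires $\operatorname{Re}(\lambda_i^M)\ge0$, $i=1,2$; the boundary of the stability region is defined by $\operatorname{Re}(\lambda)=0$, and setting $\lambda=i\mu$, $\mu\in\mathbb{R}$, in the characteristic equation and eliminating $\mu$ gives $T_R^2D_R+T_RT_ID_I-D_I^2=0$. (a) The system is stable if $T_R>0$ and $T_R^2D_R+T_RT_ID_I-D_I^2>0$. In terms of the original matrices, the stability conditions for the two-class model read $$S_1=\operatorname{tr}(TD)>0,$$ $$S_2=S_2(\epsilon)=\epsilon^2\operatorname{tr}(TD)^2\det(TD)-\frac{1}{\xi^2}\Big(\operatorname{tr}(TD)^2\det(J)-\operatorname{tr}(TD)\operatorname{tr}(J)\operatorname{tr}(TDJ)+\operatorname{tr}(TDJ)^2\Big)>0.$$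 (b) If $T_R=0$, then $\operatorname{Re}(\lambda_1^M)=-\operatorname{Re}(\lambda_2^M)$ and the stability criterion in (a) does not apply. In this regime the system is neutrally stable only if $\operatorname{Re}(\lambda_1^M)=\operatorname{Re}(\lambda_2^M)=0$; otherwise one eigenvalue necessarily has a negative real part, and thus the system is unstable. (c) If $M$ has a double eigenvalue $\lambda^M$ with $\operatorname{Re}(\lambda^M)=0$, the system is unstable as well.
   Context: The diffusively-corrected multi-class macroscopic model is $\partial_t\rho+\partial_xF(\rho)=\epsilon T\partial_x(D(\rho)\partial_x\rho)$ for the class densities $\rho=(\rho^1,\dots,\rho^N)$, here with $N=2$. Here $\epsilon>0$ is a scaling parameter, $T=\operatorname{diag}(T^1,\dots,T^N)$ is the matrix of relaxation times of the classes, and $F=(F^1,\dots,F^N)$ is the vector of class-specific fundamental diagrams. With $f^{e,c}(\rho,v)\ge0$, $v\in[0,1]$, the equilibrium functions of the underlying kinetic model, $\int f^{e,c}(\rho,v)\,dv=\rho^c$, $F^c(\rho)=\int v f^{e,c}(\rho,v)\,dv$, $E^c(\rho)=\int v^2f^{e,c}(\rho,v)\,dv$, $r=\sum_c\rho^c$ and $$C(f,g)=\iint_{\hat v<v}(v-\hat v)^2f(v)g(\hat v)\,d\hat v\,dv,$$ the diffusion matrix $D(\rho)=(D^{c,i}(\rho))$ has entries $$D^{c,i}=\partial_{\rho^i}E^c-\sum_{d=1}^N\Big(\partial_{\rho^d}F^c\,\partial_{\rho^i}F^d-\frac{1}{1-r}C(f^{e,c},\partial_{\rho^i}f^{e,d})\Big).$$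 Linearizing around a constant state $\rho_0$, $\rho=\rho_0+\tilde\rho$, with $J(\rho_0)$ the Jacobian of $F$ at $\rho_0$, gives $\partial_t\tilde\rho+J(\rho_0)\partial_x\tilde\rho=\epsilon TD(\rho_0)\partial_{xx}\tilde\rho$. Inserting $\tilde\rho(x,t)=z(t)e^{i\xi x}$ with frequency $\xi>0$ gives $z'(t)=-\xi^2Mz(t)$ with $M=\epsilon TD(\rho_0)+\frac{i}{\xi}J(\rho_0)$, so $z(t)=e^{-\xi^2Mt}z(0)$. Stability refers to boundedness of the perturbation modes as $t\to\infty$: via the Jordan form of $M$, in which each distinct eigenvalue $\lambda_j^M$ of multiplicity $m_j$ is associated with a Jordan matrix of size $m_j$, the modes evolve according to $t^ke^{-\xi^2\operatorname{Re}(\lambda_j^M)t}$ with $k\le m_j-1$. For multiplicity one, $\operatorname{Re}(\lambda_j^M)>0$ yields exponential decay and $\operatorname{Re}(\lambda_j^M)=0$ yields neutral stability (bounded oscillations); for non-trivial Jordan blocks, $\operatorname{Re}(\lambda_j^M)>0$ is required. Here $\operatorname{tr}$ and $\det$ denote trace and determinant; the symbol $i$ in $\frac{i}{\xi}$, $iT_I$, $iD_I$, $i\mu$ and $e^{i\xi x}$ is the imaginary unit (as a subscript or superscript it is an index). *)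

theory Defs
  imports "HOL-Analysis.Analysis" "HOL-Computational_Algebra.Polynomial"
begin

text \<open>
  The classes are the elements of the finite index type. An equilibrium function is
  \<open>f c \<rho> v\<close> with class \<open>c\<close>, density vector \<open>\<rho>\<close> and velocity \<open>v\<close>; only \<open>v\<close> in \<open>[0,1]\<close> and
  \<open>\<rho>\<close> in the following set are meaningful. The total density stays below 1 because of the
  factor \<open>1 / (1 - r)\<close>. Boundary points with some \<open>\<rho> $ c = 0\<close> are allowed, so all derivatives
  in \<open>\<rho>\<close> are taken within this set (they are still unique there).
\<close>

definition densities :: "(real ^ 'n) set" where
  "densities = {\<rho>. (\<forall>c. 0 \<le> \<rho> $ c) \<and> (\<Sum>c\<in>UNIV. \<rho> $ c) < 1}"

definition kinetic_equilibrium :: "('n::finite \<Rightarrow> real ^ 'n \<Rightarrow> real \<Rightarrow> real) \<Rightarrow> bool" where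
  "kinetic_equilibrium f \<longleftrightarrow>
     (\<forall>\<rho>\<in>densities. \<forall>c.
        (\<forall>v\<in>{0..1}. 0 \<le> f c \<rho> v) \<and>
        set_integrable lebesgue {0..1} (f c \<rho>) \<and>
        (LINT v:{0..1}|lebesgue. f c \<rho> v) = \<rho> $ c)"

definition flux :: "('n::finite \<Rightarrow> real ^ 'n \<Rightarrow> real \<Rightarrow> real) \<Rightarrow> real ^ 'n \<Rightarrow> real ^ 'n" where
  "flux f \<rho> = (\<chi> c. LINT v:{0..1}|lebesgue. v * f c \<rho> v)"

definition second_moment :: "('n::finite \<Rightarrow> real ^ 'n \<Rightarrow> real \<Rightarrow> real) \<Rightarrow> real ^ 'n \<Rightarrow> real ^ 'n" where
  "second_moment f \<rho> = (\<chi> c. LINT v:{0..1}|lebesgue. v\<^sup>2 * f c \<rho> v)"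

definition interaction :: "(real \<Rightarrow> real) \<Rightarrow> (real \<Rightarrow> real) \<Rightarrow> real" where
  "interaction f g =
     (LINT p:{(v, w). 0 \<le> w \<and> w < v \<and> v \<le> 1}|lebesgue. (fst p - snd p)\<^sup>2 * f (fst p) * g (snd p))"

definition line_params :: "'n::finite \<Rightarrow> real ^ 'n \<Rightarrow> real set" where
  "line_params i \<rho> = {s. \<rho> + s *\<^sub>R axis i 1 \<in> densities}"

definition partial_density ::
    "('n::finite \<Rightarrow> real ^ 'n \<Rightarrow> real \<Rightarrow> real) \<Rightarrow> 'n \<Rightarrow> 'n \<Rightarrow> real ^ 'n \<Rightarrow> real \<Rightarrow> real" where
  "partial_density f d i \<rho> v =
     vector_derivative (\<lambda>s. f d (\<rho> + s *\<^sub>R axis i 1) v) (at 0 within line_params i \<rho>)"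

text \<open>Everything that occurs in the Jacobian and in the diffusion matrix at \<open>\<rho>\<close> exists.\<close>

definition differentiable_model_at ::
    "('n::finite \<Rightarrow> real ^ 'n \<Rightarrow> real \<Rightarrow> real) \<Rightarrow> real ^ 'n \<Rightarrow> bool" where
  "differentiable_model_at f \<rho> \<longleftrightarrow>
     flux f differentiable (at \<rho> within densities) \<and>
     second_moment f differentiable (at \<rho> within densities) \<and>
     (\<forall>d i. (AE v in lebesgue. v \<in> {0..1} \<longrightarrow>
               (\<lambda>s. f d (\<rho> + s *\<^sub>R axis i 1) v) differentiable (at 0 within line_params i \<rho>)) \<and>
            set_integrable lebesgue {0..1} (partial_density f d i \<rho>))"

definition flux_jacobian ::
    "('n::finite \<Rightarrow> real ^ 'n \<Rightarrow> real \<Rightarrow> real) \<Rightarrow> real ^ 'n \<Rightarrow> real ^ 'n ^ 'n" where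
  "flux_jacobian f \<rho> = jacobian (flux f) (at \<rho> within densities)"

definition diffusion_matrix ::
    "('n::finite \<Rightarrow> real ^ 'n \<Rightarrow> real \<Rightarrow> real) \<Rightarrow> real ^ 'n \<Rightarrow> real ^ 'n ^ 'n" where
  "diffusion_matrix f \<rho> =
     (let J = flux_jacobian f \<rho>;
          K = jacobian (second_moment f) (at \<rho> within densities);
          r = (\<Sum>c\<in>UNIV. \<rho> $ c)
      in \<chi> c i. K $ c $ i -
           (\<Sum>d\<in>UNIV. J $ c $ d * J $ d $ i -
                        1 / (1 - r) * interaction (f c \<rho>) (partial_density f d i \<rho>)))"

definition diagonal_matrix :: "'a::zero ^ 'n \<Rightarrow> 'a ^ 'n ^ 'n" where
  "diagonal_matrix \<tau> = (\<chi> i j. if i = j then \<tau> $ i else 0)"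

definition perturbation_matrix ::
    "real \<Rightarrow> real \<Rightarrow> real ^ 'n ^ 'n \<Rightarrow> real ^ 'n ^ 'n \<Rightarrow> real ^ 'n ^ 'n \<Rightarrow> complex ^ 'n ^ 'n" where
  "perturbation_matrix \<epsilon> \<xi> T D J =
     (\<chi> a b. complex_of_real (\<epsilon> * (T ** D) $ a $ b) + \<i> / of_real \<xi> * of_real (J $ a $ b))"

definition charpoly :: "'a::comm_ring_1 ^ 'n ^ 'n \<Rightarrow> 'a poly" where
  "charpoly A = det (\<chi> a b. (if a = b then [:0, 1:] else 0) - [:A $ a $ b:])"

definition eigenvalue :: "'a::field ^ 'n ^ 'n \<Rightarrow> 'a \<Rightarrow> bool" where
  "eigenvalue A \<nu> \<longleftrightarrow> (\<exists>v. v \<noteq> 0 \<and> A *v v = \<nu> *s v)"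

abbreviation multiplicity_of :: "'a::field ^ 'n ^ 'n \<Rightarrow> 'a \<Rightarrow> nat" where
  "multiplicity_of A \<nu> \<equiv> order \<nu> (charpoly A)"

text \<open>
  A perturbation mode is given by a distinct eigenvalue \<open>\<nu>\<close> of multiplicity \<open>m\<close> and \<open>k \<le> m - 1\<close>:
  it evolves like the function \<open>mode \<xi> \<nu> k\<close>. Here \<open>m\<close> is the algebraic multiplicity, that is, one
  Jordan block of size \<open>m\<close> is attached to each distinct eigenvalue.
\<close>

definition mode :: "real \<Rightarrow> complex \<Rightarrow> nat \<Rightarrow> real \<Rightarrow> real" where
  "mode \<xi> \<nu> k t = t ^ k * exp (- (\<xi>\<^sup>2) * Re \<nu> * t)"

definition linearly_stable :: "real \<Rightarrow> complex ^ 'n ^ 'n \<Rightarrow> bool" where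
  "linearly_stable \<xi> M \<longleftrightarrow>
     (\<forall>\<nu> k. eigenvalue M \<nu> \<and> k < multiplicity_of M \<nu> \<longrightarrow> bounded (mode \<xi> \<nu> k ` {0..}))"

definition neutrally_stable :: "real \<Rightarrow> complex ^ 'n ^ 'n \<Rightarrow> bool" where
  "neutrally_stable \<xi> M \<longleftrightarrow> linearly_stable \<xi> M \<and>
     (\<exists>\<nu> k. eigenvalue M \<nu> \<and> k < multiplicity_of M \<nu> \<and> \<not> (mode \<xi> \<nu> k \<longlongrightarrow> 0) at_top)"

text \<open>
  The amplitudes \<open>z\<close> themselves: solutions of \<open>z' = - \<xi>\<^sup>2 M z\<close> for \<open>t \<ge> 0\<close>. Boundedness of all of them
  is equivalent to \<open>linearly_stable\<close> unless an eigenvalue on the imaginary axis has several Jordan blocks;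
  for two classes this exception is \<open>M = mat \<nu>\<close> with \<open>Re \<nu> = 0\<close>.
\<close>

definition amplitude :: "real \<Rightarrow> complex ^ 'n ^ 'n \<Rightarrow> (real \<Rightarrow> complex ^ 'n) \<Rightarrow> bool" where
  "amplitude \<xi> M z \<longleftrightarrow>
     (\<forall>t\<ge>0. (z has_vector_derivative (- (\<xi>\<^sup>2)) *\<^sub>R (M *v z t)) (at t within {0..}))"

definition amplitudes_bounded :: "real \<Rightarrow> complex ^ 'n ^ 'n \<Rightarrow> bool" where
  "amplitudes_bounded \<xi> M \<longleftrightarrow> (\<forall>z. amplitude \<xi> M z \<longrightarrow> bounded (z ` {0..}))"

end

theory Submission
  imports Defs
begin

text \<open>
  In terms of the eigenvalues, \<open>T\<^sub>R = Re \<nu>\<^sub>1 + Re \<nu>\<^sub>2\<close> and the boundary expression factors as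
  \<open>T\<^sub>R\<^sup>2 D\<^sub>R + T\<^sub>R T\<^sub>I D\<^sub>I - D\<^sub>I\<^sup>2 = Re \<nu>\<^sub>1 Re \<nu>\<^sub>2 (T\<^sub>R\<^sup>2 + (Im \<nu>\<^sub>1 - Im \<nu>\<^sub>2)\<^sup>2)\<close>,
  so its sign together with that of \<open>T\<^sub>R\<close> decides the signs of both real parts.
  Instability of the amplitudes is witnessed by the explicit solutions
  \<open>e\<^bsup>-\<xi>\<^sup>2\<nu>t\<^esup> (v - \<xi>\<^sup>2 t w)\<close> along a Jordan chain \<open>M v = \<nu> v + w\<close>, \<open>M w = \<nu> w\<close>.
\<close>

section \<open>Spectral algebra of small matrices\<close>

lemma diagonal_mat_vector_mult: "mat c *v v = c *s v" for c :: "'a::comm_semiring_1" and v :: "'a ^ 'n"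
  by (simp add: vec_eq_iff matrix_vector_mult_def mat_def if_distrib[of "\<lambda>x. x * _"] cong: if_cong)

lemma poly_charpoly: "poly (charpoly A) x = det (mat x - A)"
  unfolding charpoly_def det_def mat_def
  by (simp add: poly_sum poly_prod if_distrib[of "\<lambda>p. poly p x"] cong: if_cong)

text \<open>An eigenvector for \<open>\<nu>\<close> is a nonzero kernel vector of
  \<open>mat \<nu> - A\<close>, which exists exactly when that matrix is singular, that is, when its
  determinant vanishes.\<close>

lemma eigenvalue_iff_root: "eigenvalue A \<nu> \<longleftrightarrow> poly (charpoly A) \<nu> = 0"
proof -
  have "eigenvalue A \<nu> \<longleftrightarrow> (\<exists>v. v \<noteq> 0 \<and> (mat \<nu> - A) *v v = 0)"
    unfolding eigenvalue_def
    by (auto simp: matrix_vector_mult_diff_rdistrib diagonal_mat_vector_mult)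
  also have "\<dots> \<longleftrightarrow> \<not> invertible (mat \<nu> - A)"
    unfolding invertible_left_inverse matrix_left_invertible_ker by auto
  finally show ?thesis
    by (simp add: invertible_det_nz poly_charpoly)
qed

lemma charpoly_2: "charpoly A = [:det A, - trace A, 1:]" for A :: "'a::comm_ring_1 ^ 2 ^ 2"
  by (simp add: charpoly_def det_2 trace_def sum_2 algebra_simps)

text \<open>The factored form, applied to a vector, is what both later uses need: it makes
  \<open>(A - mat b) *v x\<close> zero or an eigenvector for \<open>a\<close>. Comparing
  coefficients gives trace \<open>a + b\<close> and determinant \<open>a * b\<close>; the rest is an
  entrywise check.\<close>

lemma cayley_hamilton_2:
  fixes A :: "'a::comm_ring_1 ^ 2 ^ 2"
  assumes "charpoly A = [:- a, 1:] * [:- b, 1:]"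
  shows "(A - mat a) *v ((A - mat b) *v x) = 0"
proof -
  have tr: "A $ 1 $ 1 + A $ 2 $ 2 = a + b" and det: "A $ 1 $ 1 * A $ 2 $ 2 - A $ 1 $ 2 * A $ 2 $ 1 = a * b"
    using assms by (auto simp: charpoly_2 det_2 trace_def sum_2 algebra_simps minus_equation_iff)
  \<comment> \<open>Eliminating the last diagonal entry through the trace leaves \<open>det'\<close>
    as the only relation between the entries.\<close>
  have d: "A $ 2 $ 2 = a + b - A $ 1 $ 1"
    using tr by (simp add: algebra_simps)
  have det': "A $ 1 $ 2 * A $ 2 $ 1 = A $ 1 $ 1 * (a + b - A $ 1 $ 1) - a * b"
    using det unfolding d by (simp add: algebra_simps)
  have "(A - mat a) ** (A - mat b) = 0"
    using det'
    by (simp add: vec_eq_iff forall_2 matrix_matrix_mult_def sum_2 mat_def d) (auto simp: algebra_simps)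
  then show ?thesis
    by (simp add: matrix_vector_mul_assoc)
qed

text \<open>Read \<open>a\<close>, \<open>b\<close> as real and imaginary part of the first
  eigenvalue and \<open>c\<close>, \<open>d\<close> as those of the second. The left side is then
  the boundary expression, because \<open>a * c - b * d\<close> and \<open>a * d + b * c\<close> are
  the parts of the product.\<close>

lemma real_part_product_identity:
  fixes a b c d :: real
  shows "(a + c)\<^sup>2 * (a * c - b * d) + (a + c) * (b + d) * (a * d + b * c) - (a * d + b * c)\<^sup>2
    = a * c * ((a + c)\<^sup>2 + (b - d)\<^sup>2)"
  by algebra

section \<open>Growth and decay of the scalar modes\<close>

lemma bounded_image_nonneg_iff:
  "bounded (g ` {0..}) \<longleftrightarrow> (\<exists>B. \<forall>t\<ge>0. norm (g t) \<le> B)" for g :: "real \<Rightarrow> 'a::real_normed_vector"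
  by (auto simp: bounded_iff)

lemma not_bounded_if_linear_growth:
  fixes g :: "real \<Rightarrow> real"
  assumes "\<delta> > 0" and "\<And>t. t \<ge> 1 \<Longrightarrow> \<delta> * t \<le> g t"
  shows "\<not> bounded (g ` {0..})"
proof
  assume "bounded (g ` {0..})"
  then obtain B where B: "\<And>t. t \<ge> 0 \<Longrightarrow> \<bar>g t\<bar> \<le> B"
    unfolding bounded_image_nonneg_iff by auto
  \<comment> \<open>Chosen so that the lower bound \<open>\<delta> * t\<close> exceeds
    \<open>B\<close> by at least \<open>\<delta>\<close>.\<close>
  define t where "t = 1 + \<bar>B\<bar> / \<delta>"
  have "t \<ge> 1" "\<delta> * t = \<delta> + \<bar>B\<bar>"
    using assms(1) by (auto simp: t_def field_simps)
  then show False
    using assms(2)[of t] B[of t] assms(1) by linarith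
qed

text \<open>For a negative real part, \<open>1 + x \<le> exp x\<close> already gives linear growth,
  and the factor \<open>t ^ k\<close> only helps once \<open>t \<ge> 1\<close>. On the imaginary
  axis the mode is \<open>t ^ k\<close>, which dominates \<open>t\<close> there.\<close>

lemma mode_unbounded:
  assumes "\<xi> > 0" and "Re \<nu> < 0 \<or> Re \<nu> = 0 \<and> k > 0"
  shows "\<not> bounded (mode \<xi> \<nu> k ` {0..})"
  using assms(2)
proof
  assume neg: "Re \<nu> < 0"
  show ?thesis
  proof (rule not_bounded_if_linear_growth)
    show pos: "- \<xi>\<^sup>2 * Re \<nu> > 0"
      using assms(1) neg by (simp add: mult_less_0_iff)
    fix t :: real assume "t \<ge> 1"
    have "- \<xi>\<^sup>2 * Re \<nu> * t \<le> exp (- \<xi>\<^sup>2 * Re \<nu> * t)"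
      using exp_ge_add_one_self[of "- \<xi>\<^sup>2 * Re \<nu> * t"] by linarith
    also have "\<dots> \<le> mode \<xi> \<nu> k t"
      using \<open>t \<ge> 1\<close> by (simp add: mode_def)
    finally show "- \<xi>\<^sup>2 * Re \<nu> * t \<le> mode \<xi> \<nu> k t" .
  qed
next
  assume "Re \<nu> = 0 \<and> k > 0"
  then show ?thesis
    by (intro not_bounded_if_linear_growth[of 1]) (auto simp: mode_def intro: self_le_power)
qed

text \<open>The exponential dominates each single term of its power series, so
  \<open>(c * t) ^ k / fact k \<le> exp (c * t)\<close>; this yields an explicit bound.\<close>

lemma mode_bounded:
  assumes "\<xi> > 0" and "Re \<nu> > 0"
  shows "bounded (mode \<xi> \<nu> k ` {0..})"
proof -
  define c where "c = \<xi>\<^sup>2 * Re \<nu>"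
  have c: "c > 0"
    using assms by (simp add: c_def)
  have "norm (mode \<xi> \<nu> k t) \<le> fact k / c ^ k" if "t \<ge> 0" for t
  proof -
    have "(\<Sum>n\<in>{k}. (c * t) ^ n /\<^sub>R fact n) \<le> (\<Sum>n. (c * t) ^ n /\<^sub>R fact n)"
      using c that by (intro sum_le_suminf summable_exp_generic) auto
    then have "(c * t) ^ k \<le> exp (c * t) * fact k"
      by (simp add: exp_def divide_simps)
    then have "t ^ k \<le> fact k / c ^ k * exp (c * t)"
      using c by (simp add: power_mult_distrib field_simps)
    moreover have "mode \<xi> \<nu> k t = t ^ k / exp (c * t)"
      by (simp add: mode_def c_def exp_minus divide_inverse)
    ultimately show ?thesis
      using that by (simp add: pos_divide_le_eq)
  qed
  then show ?thesis
    unfolding bounded_image_nonneg_iff by blast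
qed

section \<open>Boundedness of damped linear equations with bounded forcing\<close>

text \<open>Variation of constants without integrals: the integrating factor turns the equation into
  \<open>h' = exp (- \<mu> t) g\<close>, and a mean value inequality compares \<open>h\<close> with
  an explicit primitive of the bound on \<open>h'\<close>.\<close>

lemma scalar_ode_bounded:
  fixes u g :: "real \<Rightarrow> complex"
  assumes deriv: "\<And>t. t \<ge> 0 \<Longrightarrow> (u has_vector_derivative \<mu> * u t + g t) (at t within {0..})"
    and neg: "Re \<mu> < 0" and "bounded (g ` {0..})"
  shows "bounded (u ` {0..})"
proof -
  obtain C where C: "\<And>t. t \<ge> 0 \<Longrightarrow> norm (g t) \<le> C"
    using assms(3) unfolding bounded_image_nonneg_iff by auto
  have C0: "C \<ge> 0"
    using C[of 0] norm_ge_zero[of "g 0"] by linarith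
  define \<alpha> where "\<alpha> = - Re \<mu>"
  have \<alpha>: "\<alpha> > 0"
    using neg by (simp add: \<alpha>_def)
  define h where "h t = exp (- \<mu> * of_real t) * u t" for t
  have E: "((\<lambda>t. exp (- \<mu> * of_real t)) has_vector_derivative exp (- \<mu> * of_real t) * (- \<mu>)) (at t within S)" for t S
    by (rule has_vector_derivative_real_field) (auto intro!: derivative_eq_intros)
  have h: "(h has_vector_derivative exp (- \<mu> * of_real t) * g t) (at t within {0..})" if "t \<ge> 0" for t
    unfolding h_def
    by (rule has_vector_derivative_eq_rhs[OF has_vector_derivative_mult[OF E deriv[OF that]]])
       (simp add: algebra_simps)
  have "norm (u t) \<le> norm (u 0) + C / \<alpha>" if "t \<ge> 0" for t
  proof (cases "t = 0")
    case True
    then show ?thesis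
      using C0 \<alpha> by simp
  next
    case False
    then have t: "0 < t"
      using that by simp
    \<comment> \<open>A primitive of \<open>C * exp (\<alpha> * s)\<close>, which bounds the norm of
      the derivative of \<open>h\<close>.\<close>
    define \<phi> where "\<phi> s = C / \<alpha> * exp (\<alpha> * s)" for s
    have "norm (h t - h 0) \<le> \<phi> t - \<phi> 0"
    proof (rule differentiable_bound_general[OF t])
      have "continuous_on {0..} h"
        unfolding continuous_on_eq_continuous_within
        using has_vector_derivative_continuous[OF h] by simp
      then show "continuous_on {0..t} h"
        by (rule continuous_on_subset) auto
      show "continuous_on {0..t} \<phi>"
        unfolding \<phi>_def by (intro continuous_intros)
      fix s assume s: "0 < s" "s < t"
      \<comment> \<open>At an interior point the derivative within the half-line is a two-sided one;
        the open half-line makes this visible.\<close>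
      have "(h has_vector_derivative exp (- \<mu> * of_real s) * g s) (at s within {0<..})"
        using s by (intro has_vector_derivative_within_subset[OF h]) auto
      then show "(h has_vector_derivative exp (- \<mu> * of_real s) * g s) (at s)"
        using s by (simp add: at_within_open[of s "{0<..}"])
      have "(\<phi> has_field_derivative C * exp (\<alpha> * s)) (at s)"
        unfolding \<phi>_def using \<alpha> by (auto intro!: derivative_eq_intros)
      then show "(\<phi> has_vector_derivative C * exp (\<alpha> * s)) (at s)"
        by (simp add: has_real_derivative_iff_has_vector_derivative)
      show "norm (exp (- \<mu> * of_real s) * g s) \<le> C * exp (\<alpha> * s)"
        using C[of s] s by (simp add: norm_mult norm_exp_eq_Re \<alpha>_def mult.commute)
    qed
    then have "norm (h t) \<le> norm (h 0) + \<phi> t - \<phi> 0"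
      using norm_triangle_sub[of "h t" "h 0"] by linarith
    also have "\<dots> \<le> norm (u 0) + C / \<alpha> * exp (\<alpha> * t)"
      using C0 \<alpha> by (simp add: h_def \<phi>_def)
    \<comment> \<open>Since \<open>exp (\<alpha> * t) \<ge> 1\<close>, everything can carry this
      factor, which cancels on returning from \<open>h\<close> to \<open>u\<close>.\<close>
    also have "\<dots> \<le> (norm (u 0) + C / \<alpha>) * exp (\<alpha> * t)"
      using \<alpha> that mult_left_mono[of 1 "exp (\<alpha> * t)" "norm (u 0)"] by (simp add: distrib_right)
    finally show ?thesis
      by (simp add: h_def norm_mult norm_exp_eq_Re \<alpha>_def)
  qed
  then show ?thesis
    unfolding bounded_image_nonneg_iff by blast
qed

text \<open>Multiplication by the scalar \<open>\<mu>\<close> does not couple the components, so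
  each one obeys the scalar estimate.\<close>

lemma vector_ode_bounded:
  fixes z g :: "real \<Rightarrow> complex ^ 'n"
  assumes "\<And>t. t \<ge> 0 \<Longrightarrow> (z has_vector_derivative \<mu> *s z t + g t) (at t within {0..})"
    and "Re \<mu> < 0" and "bounded (g ` {0..})"
  shows "bounded (z ` {0..})"
proof -
  have "bounded ((\<lambda>t. z t $ i) ` {0..})" for i
  proof (rule scalar_ode_bounded)
    fix t :: real assume "t \<ge> 0"
    show "((\<lambda>t. z t $ i) has_vector_derivative \<mu> * z t $ i + g t $ i) (at t within {0..})"
      using bounded_linear.has_vector_derivative[OF bounded_linear_vec_nth assms(1)[OF \<open>t \<ge> 0\<close>], of i]
      by simp
  next
    show "bounded ((\<lambda>t. g t $ i) ` {0..})"
      using bounded_component_cart[OF assms(3), of i] by (simp add: image_image)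
  qed (fact assms(2))
  then have "\<exists>B. \<forall>t\<ge>0. norm (z t $ i) \<le> B" for i
    unfolding bounded_image_nonneg_iff by auto
  then obtain B where B: "\<And>i t. t \<ge> 0 \<Longrightarrow> norm (z t $ i) \<le> B i"
    by metis
  have "norm (z t) \<le> (\<Sum>i\<in>UNIV. B i)" if "t \<ge> 0" for t
  proof -
    have "norm (z t) \<le> (\<Sum>i\<in>UNIV. norm (z t $ i))"
      unfolding norm_vec_def by (rule L2_set_le_sum) simp
    also have "\<dots> \<le> (\<Sum>i\<in>UNIV. B i)"
      using B[OF that] by (rule sum_mono)
    finally show ?thesis .
  qed
  then show ?thesis
    unfolding bounded_image_nonneg_iff by blast
qed

lemma scaleR_eq_smult: "r *\<^sub>R x = of_real r *s x" for x :: "complex ^ 'n"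
  by (simp only: vec_eq_iff vector_scaleR_component vector_smult_component) (simp add: scaleR_conv_of_real)

lemma bounded_linear_smult_left: "bounded_linear (\<lambda>c. c *s v)" for v :: "complex ^ 'n"
  by (auto simp: linear_conv_bounded_linear[symmetric] vec_eq_iff algebra_simps intro!: linearI)

text \<open>With \<open>w = (M - \<nu>\<^sub>1) z\<close>, Cayley--Hamilton makes the system triangular:
  \<open>w' = - \<xi>\<^sup>2 \<nu>\<^sub>2 w\<close> and \<open>z' = - \<xi>\<^sup>2 \<nu>\<^sub>1 z - \<xi>\<^sup>2 w\<close>.\<close>

lemma amplitudes_bounded_2:
  fixes M :: "complex ^ 2 ^ 2"
  assumes xi: "\<xi> > 0" and char: "charpoly M = [:- \<nu>\<^sub>1, 1:] * [:- \<nu>\<^sub>2, 1:]"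
    and pos: "Re \<nu>\<^sub>1 > 0" "Re \<nu>\<^sub>2 > 0"
  shows "amplitudes_bounded \<xi> M"
  unfolding amplitudes_bounded_def
proof (intro allI impI)
  fix z assume z: "amplitude \<xi> M z"
  \<comment> \<open>Triangular rather than diagonal form treats distinct and equal eigenvalues
    alike, with no case split.\<close>
  define N where "N = M - mat \<nu>\<^sub>1"
  define w where "w t = N *v z t" for t
  have Mz: "M *v x = N *v x + \<nu>\<^sub>1 *s x" for x
    by (simp add: N_def matrix_vector_mult_diff_rdistrib diagonal_mat_vector_mult)
  \<comment> \<open>The factors are swapped so that \<open>N\<close> is the one that acts first on
    the vector.\<close>
  have "charpoly M = [:- \<nu>\<^sub>2, 1:] * [:- \<nu>\<^sub>1, 1:]"
    using char by (simp only: mult.commute)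
  then have "(M - mat \<nu>\<^sub>2) *v (N *v x) = 0" for x
    unfolding N_def by (rule cayley_hamilton_2)
  then have Mw: "M *v (N *v x) = \<nu>\<^sub>2 *s (N *v x)" for x
    by (simp add: matrix_vector_mult_diff_rdistrib diagonal_mat_vector_mult)
  \<comment> \<open>\<open>M\<close> and \<open>N\<close> differ by a multiple of the identity,
    hence commute.\<close>
  have "N *v (M *v x) = M *v (N *v x)" for x
    by (simp add: Mz vec.add vec.scale)
  then have NM: "N *v (M *v x) = \<nu>\<^sub>2 *s (N *v x)" for x
    by (simp add: Mw)
  have z': "(z has_vector_derivative (- (\<xi>\<^sup>2)) *\<^sub>R (M *v z t)) (at t within {0..})" if "t \<ge> 0" for t
    using z that unfolding amplitude_def by blast
  have "bounded (w ` {0..})"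
  proof (rule vector_ode_bounded)
    fix t :: real assume "t \<ge> 0"
    have "(w has_vector_derivative N *v ((- (\<xi>\<^sup>2)) *\<^sub>R (M *v z t))) (at t within {0..})"
      unfolding w_def
      by (rule bounded_linear.has_vector_derivative[OF matrix_vector_mul_bounded_linear z'[OF \<open>t \<ge> 0\<close>]])
    then show "(w has_vector_derivative (- of_real (\<xi>\<^sup>2) * \<nu>\<^sub>2) *s w t + 0) (at t within {0..})"
      by (simp add: scaleR_eq_smult vec.scale NM w_def vec.neg)
  qed (use xi pos in \<open>auto simp: image_constant_conv\<close>)
  then have bw: "bounded ((\<lambda>t. (- (\<xi>\<^sup>2)) *\<^sub>R w t) ` {0..})"
    using bounded_scaling[of "w ` {0..}" "- (\<xi>\<^sup>2)"] by (simp add: image_image)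
  show "bounded (z ` {0..})"
  proof (rule vector_ode_bounded[OF _ _ bw])
    fix t :: real assume "t \<ge> 0"
    show "(z has_vector_derivative (- of_real (\<xi>\<^sup>2) * \<nu>\<^sub>1) *s z t + (- (\<xi>\<^sup>2)) *\<^sub>R w t) (at t within {0..})"
      by (rule has_vector_derivative_eq_rhs[OF z'[OF \<open>t \<ge> 0\<close>]])
         (simp add: Mz w_def scaleR_eq_smult vec_eq_iff algebra_simps)
  qed (use xi pos in auto)
qed

section \<open>Explicit solutions and unbounded amplitudes\<close>

text \<open>The choice \<open>w = 0\<close> is allowed, so this covers plain eigenvectors as well as
  chains of length two.\<close>

lemma amplitude_Jordan_chain:
  fixes M :: "complex ^ 'n ^ 'n"
  assumes v: "M *v v = \<nu> *s v + w" and w: "M *v w = \<nu> *s w"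
  shows "amplitude \<xi> M (\<lambda>t. exp (- of_real (\<xi>\<^sup>2) * \<nu> * of_real t) *s (v - of_real (\<xi>\<^sup>2 * t) *s w))"
  unfolding amplitude_def
proof (intro allI impI)
  fix t :: real
  define c where "c = - of_real (\<xi>\<^sup>2) * \<nu>"
  define a where "a = complex_of_real (- (\<xi>\<^sup>2))"
  let ?e = "\<lambda>t::real. exp (c * of_real t)"
  \<comment> \<open>This and the next derivative come from holomorphic functions restricted to the
    real line.\<close>
  have e: "(?e has_vector_derivative exp (c * of_real t) * c) (at t within {0..})"
    by (rule has_vector_derivative_real_field) (auto intro!: derivative_eq_intros)
  have f: "((\<lambda>t. a * of_real t * ?e t) has_vector_derivative a * ?e t + a * of_real t * (?e t * c)) (at t within {0..})"
    by (rule has_vector_derivative_real_field[where f = "\<lambda>t. a * t * exp (c * t)"])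
       (auto intro!: derivative_eq_intros)
  have "((\<lambda>t. ?e t *s v + (a * of_real t * ?e t) *s w) has_vector_derivative
      (?e t * c) *s v + (a * ?e t + a * of_real t * (?e t * c)) *s w) (at t within {0..})"
    by (intro has_vector_derivative_add bounded_linear.has_vector_derivative[OF bounded_linear_smult_left] e f)
  moreover have "?e s *s v + (a * of_real s * ?e s) *s w = ?e s *s (v - of_real (\<xi>\<^sup>2 * s) *s w)" for s
    by (simp add: vec_eq_iff a_def algebra_simps)
  moreover have "(?e t * c) *s v + (a * ?e t + a * of_real t * (?e t * c)) *s w
      = (- (\<xi>\<^sup>2)) *\<^sub>R (M *v (?e t *s (v - of_real (\<xi>\<^sup>2 * t) *s w)))"
    by (simp add: vec.scale vec.diff v w scaleR_eq_smult) (simp add: vec_eq_iff a_def c_def algebra_simps)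
  ultimately show "((\<lambda>t. exp (- of_real (\<xi>\<^sup>2) * \<nu> * of_real t) *s (v - of_real (\<xi>\<^sup>2 * t) *s w))
      has_vector_derivative (- (\<xi>\<^sup>2)) *\<^sub>R (M *v (exp (- of_real (\<xi>\<^sup>2) * \<nu> * of_real t) *s (v - of_real (\<xi>\<^sup>2 * t) *s w))))
      (at t within {0..})"
    by (simp add: c_def)
qed

text \<open>A nonzero component of the eigenvector solution has modulus a constant times the mode
  with \<open>k = 0\<close>, so a bounded amplitude would bound that mode.\<close>

lemma amplitudes_unbounded_if_neg:
  fixes M :: "complex ^ 'n ^ 'n"
  assumes xi: "\<xi> > 0" and "eigenvalue M \<nu>" and neg: "Re \<nu> < 0"
  shows "\<not> amplitudes_bounded \<xi> M"
proof
  assume bd: "amplitudes_bounded \<xi> M"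
  obtain v where v: "v \<noteq> 0" "M *v v = \<nu> *s v"
    using assms(2) unfolding eigenvalue_def by blast
  then obtain i where i: "v $ i \<noteq> 0"
    by (auto simp: vec_eq_iff)
  define z where "z t = exp (- of_real (\<xi>\<^sup>2) * \<nu> * of_real t) *s v" for t :: real
  have "amplitude \<xi> M z"
    using amplitude_Jordan_chain[of M v \<nu> 0 \<xi>] v by (simp add: z_def[abs_def])
  then obtain B where B: "\<And>t. t \<ge> 0 \<Longrightarrow> norm (z t) \<le> B"
    using bd unfolding amplitudes_bounded_def bounded_image_nonneg_iff by auto
  have "norm (mode \<xi> \<nu> 0 t) \<le> B / norm (v $ i)" if "t \<ge> 0" for t
  proof -
    have "mode \<xi> \<nu> 0 t * norm (v $ i) = norm (z t $ i)"
      by (simp add: z_def mode_def norm_mult norm_exp_eq_Re)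
    also have "\<dots> \<le> B"
      using B[OF that] Finite_Cartesian_Product.norm_nth_le[of "z t" i] by linarith
    finally show ?thesis
      using i by (simp add: mode_def field_simps)
  qed
  then have "bounded (mode \<xi> \<nu> 0 ` {0..})"
    unfolding bounded_image_nonneg_iff by blast
  then show False
    using mode_unbounded[OF xi, of \<nu> 0] neg by blast
qed

text \<open>If \<open>M\<close> is not scalar, some \<open>v\<close> has
  \<open>w = (M - mat \<nu>) *v v\<close> nonzero, and Cayley-Hamilton makes \<open>v\<close>,
  \<open>w\<close> a genuine Jordan chain. Its solution grows like the mode with
  \<open>k = 1\<close>.\<close>

lemma amplitudes_unbounded_if_defective:
  fixes M :: "complex ^ 2 ^ 2"
  assumes xi: "\<xi> > 0" and char: "charpoly M = [:- \<nu>, 1:] * [:- \<nu>, 1:]"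
    and re: "Re \<nu> = 0" and ne: "M \<noteq> mat \<nu>"
  shows "\<not> amplitudes_bounded \<xi> M"
proof
  assume bd: "amplitudes_bounded \<xi> M"
  have "\<not> (\<forall>x. M *v x = mat \<nu> *v x)"
    using ne by (simp add: matrix_eq)
  then obtain v where v: "M *v v \<noteq> mat \<nu> *v v"
    by blast
  define w where "w = (M - mat \<nu>) *v v"
  have "w \<noteq> 0"
    using v by (simp add: w_def matrix_vector_mult_diff_rdistrib)
  then obtain i where i: "w $ i \<noteq> 0"
    by (auto simp: vec_eq_iff)
  have chain: "M *v v = \<nu> *s v + w" "M *v w = \<nu> *s w"
    using cayley_hamilton_2[OF char, of v]
    by (simp_all add: w_def[symmetric]) (simp_all add: w_def matrix_vector_mult_diff_rdistrib diagonal_mat_vector_mult)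
  define z where "z t = exp (- of_real (\<xi>\<^sup>2) * \<nu> * of_real t) *s (v - of_real (\<xi>\<^sup>2 * t) *s w)" for t
  have "amplitude \<xi> M z"
    unfolding z_def[abs_def] using chain by (rule amplitude_Jordan_chain)
  then obtain B where B: "\<And>t. t \<ge> 0 \<Longrightarrow> norm (z t) \<le> B"
    using bd unfolding amplitudes_bounded_def bounded_image_nonneg_iff by auto
  have "norm (mode \<xi> \<nu> 1 t) \<le> (B + norm (v $ i)) / (\<xi>\<^sup>2 * norm (w $ i))" if "t \<ge> 0" for t
  proof -
    \<comment> \<open>The exponential has modulus one because \<open>Re \<nu> = 0\<close>; the
      reverse triangle inequality then isolates the term linear in \<open>t\<close>.\<close>
    have "\<xi>\<^sup>2 * t * norm (w $ i) - norm (v $ i) = norm (of_real (\<xi>\<^sup>2 * t) * w $ i) - norm (v $ i)"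
      using that by (simp only: norm_mult norm_of_real) simp
    also have "\<dots> \<le> norm (v $ i - of_real (\<xi>\<^sup>2 * t) * w $ i)"
      by (metis norm_minus_commute norm_triangle_ineq2)
    also have "\<dots> = norm (z t $ i)"
      by (simp only: z_def vector_smult_component vector_minus_component norm_mult norm_exp_eq_Re)
         (simp add: re)
    also have "\<dots> \<le> B"
      using B[OF that] Finite_Cartesian_Product.norm_nth_le[of "z t" i] by linarith
    finally show ?thesis
      using i xi that by (simp add: mode_def re field_simps)
  qed
  then have "bounded (mode \<xi> \<nu> 1 ` {0..})"
    unfolding bounded_image_nonneg_iff by blast
  then show False
    using mode_unbounded[OF xi, of \<nu> 1] re by simp
qed

section \<open>From eigenvalues and multiplicities to stability of the modes\<close>

lemma linearly_stable_if_pos: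
  assumes "\<xi> > 0" and "\<And>\<nu>. eigenvalue M \<nu> \<Longrightarrow> Re \<nu> > 0"
  shows "linearly_stable \<xi> M"
  using assms by (auto simp: linearly_stable_def intro: mode_bounded)

text \<open>Guarantees that \<open>k = 0\<close> is an admissible mode index for every
  eigenvalue.\<close>

lemma order_pos_if_eigenvalue:
  assumes "charpoly M \<noteq> 0" and "eigenvalue M \<nu>"
  shows "multiplicity_of M \<nu> > 0"
  using assms by (simp add: eigenvalue_iff_root order_root)

lemma not_linearly_stable_if_neg:
  assumes "\<xi> > 0" "charpoly M \<noteq> 0" "eigenvalue M \<nu>" "Re \<nu> < 0"
  shows "\<not> linearly_stable \<xi> M"
  using assms mode_unbounded[of \<xi> \<nu> 0] order_pos_if_eigenvalue[of M \<nu>]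
  unfolding linearly_stable_def by blast

lemma order_linear_factor: "order x [:- a, 1:] = (if x = a then 1 else 0)" for x :: "'a::idom"
  using order_power_n_n[of a 1] by (auto intro: order_0I)

section \<open>Stability criterion, degenerate trace and double eigenvalues for two classes\<close>

theorem mainTheorem5:
  fixes f :: "2 \<Rightarrow> real ^ 2 \<Rightarrow> real \<Rightarrow> real"
    and \<rho>\<^sub>0 \<tau> :: "real ^ 2"
    and \<epsilon> \<xi> :: real
    and T D J :: "real ^ 2 ^ 2"
    and M :: "complex ^ 2 ^ 2"
    and \<nu>\<^sub>1 \<nu>\<^sub>2 :: complex
    and T\<^sub>R T\<^sub>I D\<^sub>R D\<^sub>I S\<^sub>1 S\<^sub>2 :: real
  assumes equilibrium: "kinetic_equilibrium f"
    and state: "\<rho>\<^sub>0 \<in> densities"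
    and smooth: "differentiable_model_at f \<rho>\<^sub>0"
    and eps: "\<epsilon> > 0"
    and xi: "\<xi> > 0"
    and relaxation: "\<And>c. \<tau> $ c > 0"
    and T: "T = diagonal_matrix \<tau>"
    and D: "D = diffusion_matrix f \<rho>\<^sub>0"
    and J: "J = flux_jacobian f \<rho>\<^sub>0"
    and M: "M = perturbation_matrix \<epsilon> \<xi> T D J"
    and eigenvalues: "charpoly M = [:- \<nu>\<^sub>1, 1:] * [:- \<nu>\<^sub>2, 1:]"
    and T_R: "T\<^sub>R = \<epsilon> * trace (T ** D)"
    and T_I: "T\<^sub>I = 1 / \<xi> * trace J"
    and D_R: "D\<^sub>R = \<epsilon>\<^sup>2 * det (T ** D) - 1 / \<xi>\<^sup>2 * det J"
    and D_I: "D\<^sub>I = \<epsilon> / \<xi> * (trace (T ** D) * trace J - trace (T ** D ** J))"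
    and S_1: "S\<^sub>1 = trace (T ** D)"
    and S_2: "S\<^sub>2 = \<epsilon>\<^sup>2 * (trace (T ** D))\<^sup>2 * det (T ** D) -
                1 / \<xi>\<^sup>2 * ((trace (T ** D))\<^sup>2 * det J -
                  trace (T ** D) * trace J * trace (T ** D ** J) + (trace (T ** D ** J))\<^sup>2)"
  shows "
     \<comment> \<open>characteristic equation, trace and determinant\<close>
     ((\<forall>\<nu>. eigenvalue M \<nu> \<longleftrightarrow> \<nu> = \<nu>\<^sub>1 \<or> \<nu> = \<nu>\<^sub>2) \<and>
     (\<forall>\<nu>\<in>{\<nu>\<^sub>1, \<nu>\<^sub>2}. \<nu>\<^sup>2 - trace M * \<nu> + det M = 0) \<and>
     trace M = of_real T\<^sub>R + \<i> * of_real T\<^sub>I \<and>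
     det M = of_real D\<^sub>R + \<i> * of_real D\<^sub>I) \<and>
     \<comment> \<open>necessary condition and boundary of the stability region\<close>
     ((linearly_stable \<xi> M \<or> amplitudes_bounded \<xi> M) \<longrightarrow> Re \<nu>\<^sub>1 \<ge> 0 \<and> Re \<nu>\<^sub>2 \<ge> 0) \<and>
     (\<forall>\<mu>::real. (\<i> * of_real \<mu>)\<^sup>2 - trace M * (\<i> * of_real \<mu>) + det M = 0 \<longrightarrow>
       T\<^sub>R\<^sup>2 * D\<^sub>R + T\<^sub>R * T\<^sub>I * D\<^sub>I - D\<^sub>I\<^sup>2 = 0) \<and>
     (Re \<nu>\<^sub>1 = 0 \<or> Re \<nu>\<^sub>2 = 0 \<longrightarrow> T\<^sub>R\<^sup>2 * D\<^sub>R + T\<^sub>R * T\<^sub>I * D\<^sub>I - D\<^sub>I\<^sup>2 = 0) \<and>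
     (T\<^sub>R \<noteq> 0 \<and> T\<^sub>R\<^sup>2 * D\<^sub>R + T\<^sub>R * T\<^sub>I * D\<^sub>I - D\<^sub>I\<^sup>2 = 0 \<longrightarrow> Re \<nu>\<^sub>1 = 0 \<or> Re \<nu>\<^sub>2 = 0) \<and>
     \<comment> \<open>(a)\<close>
     (T\<^sub>R > 0 \<and> T\<^sub>R\<^sup>2 * D\<^sub>R + T\<^sub>R * T\<^sub>I * D\<^sub>I - D\<^sub>I\<^sup>2 > 0 \<longrightarrow> linearly_stable \<xi> M \<and> amplitudes_bounded \<xi> M) \<and>
     (T\<^sub>R > 0 \<and> T\<^sub>R\<^sup>2 * D\<^sub>R + T\<^sub>R * T\<^sub>I * D\<^sub>I - D\<^sub>I\<^sup>2 > 0 \<longleftrightarrow> S\<^sub>1 > 0 \<and> S\<^sub>2 > 0) \<and>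
     (S\<^sub>1 > 0 \<and> S\<^sub>2 > 0 \<longrightarrow> linearly_stable \<xi> M \<and> amplitudes_bounded \<xi> M) \<and>
     \<comment> \<open>(b)\<close>
     (T\<^sub>R = 0 \<longrightarrow>
       Re \<nu>\<^sub>1 = - Re \<nu>\<^sub>2 \<and>
       \<not> (T\<^sub>R > 0 \<and> T\<^sub>R\<^sup>2 * D\<^sub>R + T\<^sub>R * T\<^sub>I * D\<^sub>I - D\<^sub>I\<^sup>2 > 0) \<and>
       (neutrally_stable \<xi> M \<longrightarrow> Re \<nu>\<^sub>1 = 0 \<and> Re \<nu>\<^sub>2 = 0) \<and>
       (\<not> (Re \<nu>\<^sub>1 = 0 \<and> Re \<nu>\<^sub>2 = 0) \<longrightarrow>
          (Re \<nu>\<^sub>1 < 0 \<or> Re \<nu>\<^sub>2 < 0) \<and> \<not> linearly_stable \<xi> M \<and> \<not> amplitudes_bounded \<xi> M)) \<and>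
     \<comment> \<open>(c); the amplitudes are unbounded whenever the Jordan block is non-trivial\<close>
     (\<forall>\<nu>. eigenvalue M \<nu> \<and> multiplicity_of M \<nu> = 2 \<and> Re \<nu> = 0 \<longrightarrow>
       \<not> linearly_stable \<xi> M \<and> (M \<noteq> mat \<nu> \<longrightarrow> \<not> amplitudes_bounded \<xi> M))"
proof -
  define A where "A = T ** D"
  have M_nth: "M $ a $ b = of_real (\<epsilon> * A $ a $ b) + \<i> / of_real \<xi> * of_real (J $ a $ b)" for a b
    by (simp add: M perturbation_matrix_def A_def)
  have trM: "trace M = of_real T\<^sub>R + \<i> * of_real T\<^sub>I"
    unfolding T_R T_I A_def[symmetric]
    by (simp add: trace_def sum_2 M_nth complex_eq_iff algebra_simps add_divide_distrib)
  have detM: "det M = of_real D\<^sub>R + \<i> * of_real D\<^sub>I"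
    unfolding D_R D_I A_def[symmetric] using xi
    by (simp add: det_2 trace_def sum_2 matrix_matrix_mult_def M_nth complex_eq_iff field_simps power2_eq_square)
  have sum: "trace M = \<nu>\<^sub>1 + \<nu>\<^sub>2" and prod: "det M = \<nu>\<^sub>1 * \<nu>\<^sub>2"
    using eigenvalues by (auto simp: charpoly_2 algebra_simps minus_equation_iff)
  have eig: "eigenvalue M \<nu> \<longleftrightarrow> \<nu> = \<nu>\<^sub>1 \<or> \<nu> = \<nu>\<^sub>2" for \<nu>
    unfolding eigenvalue_iff_root eigenvalues poly_mult mult_eq_0_iff by (auto simp: add_eq_0_iff)
  have char: "\<nu>\<^sup>2 - trace M * \<nu> + det M = (\<nu> - \<nu>\<^sub>1) * (\<nu> - \<nu>\<^sub>2)" for \<nu>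
    by (simp add: sum prod power2_eq_square algebra_simps)
  have char0: "charpoly M \<noteq> 0"
    by (simp add: charpoly_2)
  define H where "H = T\<^sub>R\<^sup>2 * D\<^sub>R + T\<^sub>R * T\<^sub>I * D\<^sub>I - D\<^sub>I\<^sup>2"
  have parts: "T\<^sub>R = Re \<nu>\<^sub>1 + Re \<nu>\<^sub>2" "T\<^sub>I = Im \<nu>\<^sub>1 + Im \<nu>\<^sub>2"
    "D\<^sub>R = Re \<nu>\<^sub>1 * Re \<nu>\<^sub>2 - Im \<nu>\<^sub>1 * Im \<nu>\<^sub>2" "D\<^sub>I = Re \<nu>\<^sub>1 * Im \<nu>\<^sub>2 + Im \<nu>\<^sub>1 * Re \<nu>\<^sub>2"
    using trM detM by (auto simp: sum prod complex_eq_iff)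
  have H: "H = Re \<nu>\<^sub>1 * Re \<nu>\<^sub>2 * (T\<^sub>R\<^sup>2 + (Im \<nu>\<^sub>1 - Im \<nu>\<^sub>2)\<^sup>2)"
    unfolding H_def parts by (rule real_part_product_identity)
  \<comment> \<open>The two pairs of conditions differ only by the positive factors
    \<open>\<epsilon>\<close> and \<open>\<epsilon>\<^sup>2\<close>.\<close>
  have S: "T\<^sub>R = \<epsilon> * S\<^sub>1" "H = \<epsilon>\<^sup>2 * S\<^sub>2"
    using xi by (simp_all add: H_def T_R S_1 S_2 T_I D_R D_I field_simps power2_eq_square)
  have S_iff: "T\<^sub>R > 0 \<and> H > 0 \<longleftrightarrow> S\<^sub>1 > 0 \<and> S\<^sub>2 > 0"
    using eps by (simp add: S zero_less_mult_iff)
  have stable: "linearly_stable \<xi> M \<and> amplitudes_bounded \<xi> M" if "T\<^sub>R > 0" "H > 0"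
  proof -
    \<comment> \<open>The other factor of \<open>H\<close> is a sum of squares. Real parts of equal
      sign with positive sum \<open>T\<^sub>R\<close> are both positive.\<close>
    have "Re \<nu>\<^sub>1 * Re \<nu>\<^sub>2 > 0"
      using that(2) unfolding H by (smt (verit) zero_less_mult_iff zero_le_power2)
    then have pos: "Re \<nu>\<^sub>1 > 0" "Re \<nu>\<^sub>2 > 0"
      using that(1) by (auto simp: parts zero_less_mult_iff)
    then show ?thesis
      using amplitudes_bounded_2[OF xi eigenvalues] linearly_stable_if_pos[OF xi, of M] eig by auto
  qed
  have unstable: "\<not> linearly_stable \<xi> M \<and> \<not> amplitudes_bounded \<xi> M" if "Re \<nu>\<^sub>1 < 0 \<or> Re \<nu>\<^sub>2 < 0"
    using that eig not_linearly_stable_if_neg[OF xi char0] amplitudes_unbounded_if_neg[OF xi] by blast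
  have boundary: "H = 0" if "Re \<nu>\<^sub>1 = 0 \<or> Re \<nu>\<^sub>2 = 0"
    using that by (auto simp: H)
  have imaginary_root: "H = 0" if "(\<i> * of_real \<mu>)\<^sup>2 - trace M * (\<i> * of_real \<mu>) + det M = 0" for \<mu> :: real
  proof (rule boundary)
    have "\<i> * of_real \<mu> = \<nu>\<^sub>1 \<or> \<i> * of_real \<mu> = \<nu>\<^sub>2"
      using that unfolding char by simp
    then show "Re \<nu>\<^sub>1 = 0 \<or> Re \<nu>\<^sub>2 = 0"
      by auto
  qed
  \<comment> \<open>With \<open>T\<^sub>R \<noteq> 0\<close> the sum of squares in \<open>H\<close>
    is positive, so one of the real parts must vanish.\<close>
  have boundary_conv: "Re \<nu>\<^sub>1 = 0 \<or> Re \<nu>\<^sub>2 = 0" if "T\<^sub>R \<noteq> 0" "H = 0"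
    using that by (auto simp: H add_nonneg_eq_0_iff)
  have defective: "\<not> linearly_stable \<xi> M \<and> (M \<noteq> mat \<nu> \<longrightarrow> \<not> amplitudes_bounded \<xi> M)"
    if \<nu>: "eigenvalue M \<nu>" "multiplicity_of M \<nu> = 2" "Re \<nu> = 0" for \<nu>
  proof -
    \<comment> \<open>Each linear factor contributes at most one to the order, so order two forces
      both roots to equal \<open>\<nu>\<close>. The index \<open>k = 1\<close> is then admissible
      and gives the unbounded mode \<open>t\<close>.\<close>
    have "order \<nu> [:- \<nu>\<^sub>1, 1:] + order \<nu> [:- \<nu>\<^sub>2, 1:] = 2"
      using \<nu>(2) order_mult[OF char0[unfolded eigenvalues], of \<nu>] unfolding eigenvalues by linarith
    then have "\<nu>\<^sub>1 = \<nu>" "\<nu>\<^sub>2 = \<nu>"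
      by (auto simp: order_linear_factor split: if_splits)
    then show ?thesis
      using \<nu> mode_unbounded[OF xi, of \<nu> 1] amplitudes_unbounded_if_defective[OF xi _ \<nu>(3), of M] eigenvalues
      unfolding linearly_stable_def by (metis one_less_numeral_iff semiring_norm(76) zero_less_one)
  qed
  show ?thesis
    unfolding H_def[symmetric]
  proof (intro conjI)
    show "linearly_stable \<xi> M \<or> amplitudes_bounded \<xi> M \<longrightarrow> Re \<nu>\<^sub>1 \<ge> 0 \<and> Re \<nu>\<^sub>2 \<ge> 0"
      using unstable by force
    show "T\<^sub>R = 0 \<longrightarrow> Re \<nu>\<^sub>1 = - Re \<nu>\<^sub>2 \<and> \<not> (T\<^sub>R > 0 \<and> H > 0) \<and>
       (neutrally_stable \<xi> M \<longrightarrow> Re \<nu>\<^sub>1 = 0 \<and> Re \<nu>\<^sub>2 = 0) \<and>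
       (\<not> (Re \<nu>\<^sub>1 = 0 \<and> Re \<nu>\<^sub>2 = 0) \<longrightarrow>
          (Re \<nu>\<^sub>1 < 0 \<or> Re \<nu>\<^sub>2 < 0) \<and> \<not> linearly_stable \<xi> M \<and> \<not> amplitudes_bounded \<xi> M)"
    proof (cases "Re \<nu>\<^sub>1 < 0 \<or> Re \<nu>\<^sub>2 < 0")
      case True
      then show ?thesis
        using unstable by (auto simp: parts neutrally_stable_def)
    next
      \<comment> \<open>Two nonnegative real parts with sum \<open>T\<^sub>R = 0\<close> both
        vanish.\<close>
      case False
      then show ?thesis
        by (auto simp: parts)
    qed
  qed (use eig char trM detM imaginary_root boundary boundary_conv stable S_iff defective in auto)
qed

end
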